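(* Let $\mathbf{d}=(d_1,\dots,d_n)$ be a multigraphical sequence. Then $\mathbf{d}$ admits a realization which is a $C_4$-pivotable multigraph if and only if $\sum_{i=1}^n d_i=4(n-1)-4$ and $d_n\ge 2$.
   Context: A degree sequence is non-increasing, $d_1\ge\dots\ge d_n\ge 0$; it is multigraphical if some loopless multigraph on $v_1,\dots,v_n$ has $\deg(v_i)=d_i$ (a realization). A spanning tree of a multigraph is a set of edges (specific parallel copies) forming a tree on all vertices. A loopless multigraph $G$ on $n$ vertices with exactly $2n-4$ edges is a $C_4$-pivotable multigraph if $G$ contains an induced cycle $C$ of length 4 (the central cycle; induced meaning no chords, and additionally each edge of $C$ has multiplicity exactly one in $G$) and two spanning trees having exactly two common edges, both of which are edges of $C$. *)

theory Defs imports Main begin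

text \<open>Edges carry their own identity, so parallel edges are different elements of \<open>edges G\<close>
  with the same set of end vertices.\<close>

record ('v, 'e) multigraph =
  verts :: "'v set"
  edges :: "'e set"
  ends  :: "'e \<Rightarrow> 'v set"

definition loopless_multigraph :: "('v, 'e) multigraph \<Rightarrow> bool" where
  "loopless_multigraph G \<longleftrightarrow>
     finite (verts G) \<and> finite (edges G) \<and>
     (\<forall>e\<in>edges G. ends G e \<subseteq> verts G \<and> card (ends G e) = 2)"

text \<open>Counting incident edges is the degree because there are no loops.\<close>

definition deg :: "('v, 'e) multigraph \<Rightarrow> 'v \<Rightarrow> nat" where
  "deg G v = card {e \<in> edges G. v \<in> ends G e}"

definition multiplicity :: "('v, 'e) multigraph \<Rightarrow> 'v set \<Rightarrow> nat" where
  "multiplicity G p = card {e \<in> edges G. ends G e = p}"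

text \<open>The cycle visits \<open>vs ! 0, vs ! 1, \<dots>\<close> in this order and \<open>es ! i\<close> leads from \<open>vs ! i\<close> to its
  cyclic successor. Two parallel edges form a cycle of length 2.\<close>

definition is_cycle :: "('v, 'e) multigraph \<Rightarrow> 'v list \<Rightarrow> 'e list \<Rightarrow> bool" where
  "is_cycle G vs es \<longleftrightarrow>
     vs \<noteq> [] \<and> length es = length vs \<and> distinct vs \<and> distinct es \<and>
     set vs \<subseteq> verts G \<and> set es \<subseteq> edges G \<and>
     (\<forall>i < length vs. ends G (es ! i) = {vs ! i, vs ! (Suc i mod length vs)})"

definition is_connected :: "('v, 'e) multigraph \<Rightarrow> bool" where
  "is_connected G \<longleftrightarrow> verts G \<noteq> {} \<and>
     (\<forall>u\<in>verts G. \<forall>v\<in>verts G. (u, v) \<in> {(x, y). \<exists>e\<in>edges G. ends G e = {x, y}}\<^sup>*)"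

definition is_tree :: "('v, 'e) multigraph \<Rightarrow> bool" where
  "is_tree G \<longleftrightarrow> is_connected G \<and> (\<nexists>vs es. is_cycle G vs es)"

definition spanning_tree :: "('v, 'e) multigraph \<Rightarrow> 'e set \<Rightarrow> bool" where
  "spanning_tree G T \<longleftrightarrow> T \<subseteq> edges G \<and> is_tree (G\<lparr>edges := T\<rparr>)"

text \<open>Chordless, and every edge of the cycle has multiplicity one in the whole multigraph.\<close>

definition induced_cycle :: "('v, 'e) multigraph \<Rightarrow> 'v list \<Rightarrow> 'e list \<Rightarrow> bool" where
  "induced_cycle G vs es \<longleftrightarrow>
     is_cycle G vs es \<and>
     (\<forall>e\<in>edges G. ends G e \<subseteq> set vs \<longrightarrow> (\<exists>f\<in>set es. ends G e = ends G f)) \<and>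
     (\<forall>f\<in>set es. multiplicity G (ends G f) = 1)"

definition C4_pivotable :: "('v, 'e) multigraph \<Rightarrow> bool" where
  "C4_pivotable G \<longleftrightarrow>
     loopless_multigraph G \<and>
     int (card (edges G)) = 2 * int (card (verts G)) - 4 \<and>
     (\<exists>vs es. induced_cycle G vs es \<and> length vs = 4 \<and>
        (\<exists>S T. spanning_tree G S \<and> spanning_tree G T \<and>
           card (S \<inter> T) = 2 \<and> S \<inter> T \<subseteq> set es))"

text \<open>A sequence is given by \<open>n\<close> and \<open>d\<close>; only the values \<open>d 1, \<dots>, d n\<close> matter, and the vertex
  \<open>v\<^sub>i\<close> is the number \<open>i\<close>.\<close>

definition degree_sequence :: "nat \<Rightarrow> (nat \<Rightarrow> nat) \<Rightarrow> bool" where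
  "degree_sequence n d \<longleftrightarrow> (\<forall>i j. 1 \<le> i \<and> i \<le> j \<and> j \<le> n \<longrightarrow> d j \<le> d i)"

definition realization :: "(nat, 'e) multigraph \<Rightarrow> nat \<Rightarrow> (nat \<Rightarrow> nat) \<Rightarrow> bool" where
  "realization G n d \<longleftrightarrow>
     loopless_multigraph G \<and> verts G = {1..n} \<and> (\<forall>i\<in>{1..n}. deg G i = d i)"

text \<open>Edge sets are finite, so taking natural numbers as edge names is no restriction.\<close>

definition multigraphical :: "nat \<Rightarrow> (nat \<Rightarrow> nat) \<Rightarrow> bool" where
  "multigraphical n d \<longleftrightarrow>
     degree_sequence n d \<and> (\<exists>G :: (nat, nat) multigraph. realization G n d)"

end

theory Submission imports Defs begin

text \<open>If some \<open>v\<close> had degree 1, its edge would lie in both spanning trees, hence on the central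
  cycle, which would give \<open>v\<close> degree 2; the sum condition is the handshake lemma. Conversely, induct
  on the number of vertices, keeping \<open>S \<union> T\<close> equal to the whole edge set. For \<open>n > 4\<close> some vertex
  has degree 2 or 3. A new vertex of degree 2 is attached by one edge of \<open>S\<close> and one of \<open>T\<close>; a new
  vertex of degree 3 subdivides an edge off the central cycle, which lies in only one of the two trees,
  and is attached by one further edge to the other. Neither operation touches the central cycle.\<close>

section \<open>Connected multigraphs and trees\<close>

text \<open>The end map and the edge set are separate arguments, so that edges can be removed or
  inserted while the rest of the multigraph stays fixed.\<close>

definition adj :: "('e \<Rightarrow> 'v set) \<Rightarrow> 'e set \<Rightarrow> ('v \<times> 'v) set" where
  "adj f E = {(x, y). \<exists>e\<in>E. f e = {x, y}}"

lemma is_connected_adj: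
  "is_connected G \<longleftrightarrow> verts G \<noteq> {} \<and>
    (\<forall>u\<in>verts G. \<forall>v\<in>verts G. (u, v) \<in> (adj (ends G) (edges G))\<^sup>*)"
  by (simp add: is_connected_def adj_def)

lemma adjI: "e \<in> E \<Longrightarrow> f e = {x, y} \<Longrightarrow> (x, y) \<in> adj f E"
  by (auto simp: adj_def)

lemma sym_adj_rtrancl: "(x, y) \<in> (adj f E)\<^sup>* \<Longrightarrow> (y, x) \<in> (adj f E)\<^sup>*"
proof -
  have "sym (adj f E)"
    by (auto simp: sym_def adj_def insert_commute)
  then show "(x, y) \<in> (adj f E)\<^sup>* \<Longrightarrow> (y, x) \<in> (adj f E)\<^sup>*"
    by (meson sym_rtrancl symD)
qed

text \<open>A walk that uses \<open>e\<close> is cut at its first and its last passage through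
  \<open>e\<close>; the initial and the final piece then run inside \<open>E\<close>.\<close>

lemma adj_insert_rtrancl:
  assumes "(v, w) \<in> (adj f (insert e E))\<^sup>*" "f e = {x, y}"
  shows "(v, w) \<in> (adj f E)\<^sup>* \<or>
    ((v, x) \<in> (adj f E)\<^sup>* \<or> (v, y) \<in> (adj f E)\<^sup>*) \<and>
    ((x, w) \<in> (adj f E)\<^sup>* \<or> (y, w) \<in> (adj f E)\<^sup>*)"
  using assms(1)
proof (induction rule: converse_rtrancl_induct)
  case base
  then show ?case by simp
next
  case (step u v)
  from step(1) consider "(u, v) \<in> adj f E" | "f e = {u, v}"
    by (auto simp: adj_def)
  then show ?case
  proof cases
    case 1
    then show ?thesis using step(3) by (meson converse_rtrancl_into_rtrancl)
  next
    case 2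
    then have "u = x \<and> v = y \<or> u = y \<and> v = x"
      using assms(2) by (auto simp: doubleton_eq_iff)
    then show ?thesis using step(3) by auto
  qed
qed

text \<open>Deleting an edge splits at most one component into two, so adding one end of that edge
  to \<open>W\<close> is enough to meet every component again. For a singleton \<open>W\<close> this
  is the bound that a connected multigraph has at least \<open>card V - 1\<close> edges.\<close>

lemma card_verts_le_edges_plus_hitting_set:
  assumes "finite E" "\<forall>e\<in>E. \<exists>x\<in>V. \<exists>y\<in>V. f e = {x, y}" "finite W" "W \<subseteq> V"
    and "\<forall>v\<in>V. \<exists>w\<in>W. (v, w) \<in> (adj f E)\<^sup>*"
  shows "card V \<le> card E + card W"
  using assms
proof (induction E arbitrary: W rule: finite_induct)
  case empty
  have "adj f {} = {}" by (simp add: adj_def)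
  with empty have "V \<subseteq> W" by auto
  then show ?case using empty by (simp add: card_mono)
next
  case (insert e E)
  obtain x y where xy: "x \<in> V" "y \<in> V" "f e = {x, y}"
    using insert.prems(1) by blast
  let ?r = "(adj f E)\<^sup>*"
  obtain w where w: "w \<in> W" "(x, w) \<in> (adj f (insert e E))\<^sup>*"
    using insert.prems(4) xy by blast
  from adj_insert_rtrancl[OF w(2) xy(3)] have "(x, w) \<in> ?r \<or> (y, w) \<in> ?r"
    by blast
  \<comment> \<open>The end \<open>a\<close> still reaches \<open>W\<close> without
    \<open>e\<close>, so only the other end \<open>b\<close> has to join \<open>W\<close>.\<close>
  then obtain a b where ab: "{a, b} = {x, y}" "(a, w) \<in> ?r"
    by blast
  have abV: "a \<in> V" "b \<in> V" using ab(1) xy by (auto simp: doubleton_eq_iff)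
  have "\<exists>u\<in>insert b W. (v, u) \<in> ?r" if vV: "v \<in> V" for v
  proof -
    obtain u where u: "u \<in> W" "(v, u) \<in> (adj f (insert e E))\<^sup>*"
      using bspec[OF insert.prems(4) vV] by (elim bexE)
    from adj_insert_rtrancl[OF u(2), of a b] ab(1) xy(3)
    have "(v, u) \<in> ?r \<or> (v, a) \<in> ?r \<or> (v, b) \<in> ?r" by argo
    then show ?thesis
    proof (elim disjE)
      assume "(v, a) \<in> ?r"
      then show ?thesis using w(1) rtrancl_trans[OF _ ab(2)] by blast
    qed (use u(1) in auto)
  qed
  then have "card V \<le> card E + card (insert b W)"
    using insert.prems abV by (intro insert.IH) auto
  also have "\<dots> \<le> card E + Suc (card W)"
    by (simp add: insert.prems(2) card_insert_if)
  finally show ?case using insert.hyps by simp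
qed

text \<open>An edge of a cycle can be deleted without losing connectedness, which would leave one
  edge fewer than a connected multigraph on these vertices must have.\<close>

lemma is_tree_if_connected_card:
  assumes G: "loopless_multigraph G" and con: "is_connected G"
    and card: "card (edges G) + 1 = card (verts G)"
  shows "is_tree G"
proof -
  have False if cyc: "is_cycle G vs es" for vs es
  proof -
    let ?k = "length vs" and ?f = "ends G"
    define e where "e = es ! (?k - 1)"
    let ?E = "edges G - {e}"
    have k: "?k > 0" "length es = ?k" using cyc by (auto simp: is_cycle_def)
    have e: "e \<in> edges G" "?f e = {vs ! (?k - 1), vs ! 0}"
      using cyc k by (auto simp: is_cycle_def e_def)
    \<comment> \<open>The closing edge \<open>e\<close> has the last index, so walking along the
      cycle from its first to its last vertex avoids \<open>e\<close>.\<close>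
    have path: "(vs ! 0, vs ! j) \<in> (adj ?f ?E)\<^sup>*" if "j < ?k" for j
      using that
    proof (induction j)
      case (Suc j)
      have "es ! j \<in> ?E"
        using cyc Suc.prems k by (auto simp: is_cycle_def e_def nth_eq_iff_index_eq)
      moreover have "?f (es ! j) = {vs ! j, vs ! Suc j}"
        using cyc Suc.prems by (auto simp: is_cycle_def)
      ultimately show ?case using Suc by (meson Suc_lessD adjI rtrancl.rtrancl_into_rtrancl)
    qed simp
    have ends: "\<forall>e\<in>edges G. \<exists>x\<in>verts G. \<exists>y\<in>verts G. ?f e = {x, y}"
    proof
      fix e assume "e \<in> edges G"
      then have "?f e \<subseteq> verts G" "card (?f e) = 2" using G by (auto simp: loopless_multigraph_def)
      then show "\<exists>x\<in>verts G. \<exists>y\<in>verts G. ?f e = {x, y}" by (auto simp: card_2_iff)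
    qed
    have *: "(u, v) \<in> (adj ?f ?E)\<^sup>*" if "(u, v) \<in> (adj ?f (edges G))\<^sup>*" for u v
    proof -
      have ins: "insert e ?E = edges G" using e by auto
      have 1: "(vs ! 0, vs ! (?k - 1)) \<in> (adj ?f ?E)\<^sup>*" using path k by simp
      note 2 = sym_adj_rtrancl[OF 1]
      show ?thesis using adj_insert_rtrancl[of u v ?f e ?E, unfolded ins, OF that e(2)] 1 2
        by (meson rtrancl_trans)
    qed
    obtain w where w: "w \<in> verts G" using con by (auto simp: is_connected_def)
    have "card (verts G) \<le> card ?E + card {w}"
    proof (rule card_verts_le_edges_plus_hitting_set)
      show "finite ?E" using G by (simp add: loopless_multigraph_def)
      show "\<forall>e\<in>?E. \<exists>x\<in>verts G. \<exists>y\<in>verts G. ?f e = {x, y}" using ends by blast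
      show "\<forall>v\<in>verts G. \<exists>w\<in>{w}. (v, w) \<in> (adj ?f ?E)\<^sup>*"
        using con w * by (simp add: is_connected_adj)
    qed (use w in auto)
    moreover have "card ?E < card (edges G)"
      using e(1) G by (intro card_Diff1_less) (auto simp: loopless_multigraph_def)
    ultimately show False using card by simp
  qed
  then show ?thesis using con by (auto simp: is_tree_def)
qed

text \<open>Old edges need not survive; their ends only have to remain joined by a walk. This form
  covers both the attachment of a leaf and the subdivision of an edge.\<close>

lemma is_connected_insert_vertex:
  assumes con: "is_connected G"
    and old: "\<And>x y. (x, y) \<in> adj (ends G) (edges G) \<Longrightarrow> (x, y) \<in> (adj f E)\<^sup>*"
    and new: "x \<in> verts G" "(v, x) \<in> (adj f E)\<^sup>*"
  shows "is_connected \<lparr>verts = insert v (verts G), edges = E, ends = f\<rparr>"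
proof -
  have *: "(a, b) \<in> (adj f E)\<^sup>*" if "(a, b) \<in> (adj (ends G) (edges G))\<^sup>*" for a b
    using that by (induction rule: rtrancl_induct) (auto dest: old intro: rtrancl_trans)
  have "(u, x) \<in> (adj f E)\<^sup>*" if "u \<in> insert v (verts G)" for u
    using that con new * by (auto simp: is_connected_adj)
  then show ?thesis
    by (auto simp: is_connected_adj intro: rtrancl_trans sym_adj_rtrancl)
qed

text \<open>Agreement of \<open>f\<close> with \<open>ends G\<close> is asked for on
  \<open>R\<close> only, because \<open>f\<close> may give new ends to an edge of the other
  tree.\<close>

lemma is_connected_add_leaf:
  assumes con: "is_connected (G\<lparr>edges := R\<rparr>)" and x: "x \<in> verts G" and e: "f e = {v, x}"
    and f: "\<And>a. a \<in> R \<Longrightarrow> f a = ends G a"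
  shows "is_connected \<lparr>verts = insert v (verts G), edges = insert e R, ends = f\<rparr>"
proof -
  have "(a, b) \<in> (adj f (insert e R))\<^sup>*" if "(a, b) \<in> adj (ends G) R" for a b
  proof -
    have "(a, b) \<in> adj f (insert e R)" using that f by (auto simp: adj_def)
    then show ?thesis by (rule r_into_rtrancl)
  qed
  moreover have "(v, x) \<in> (adj f (insert e R))\<^sup>*"
    using e by (intro r_into_rtrancl adjI[of e]) auto
  ultimately show ?thesis
    using is_connected_insert_vertex[OF con, of f "insert e R" x v] x by simp
qed

lemma connected_has_incident_edge:
  assumes "is_connected G" "u \<in> verts G" "v \<in> verts G" "u \<noteq> v"
  shows "\<exists>e\<in>edges G. v \<in> ends G e"
proof -
  have "(v, u) \<in> (adj (ends G) (edges G))\<^sup>*"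
    using assms by (simp add: is_connected_adj)
  then show ?thesis
    by (cases rule: converse_rtranclE) (use assms in \<open>auto simp: adj_def\<close>)
qed

section \<open>Degrees\<close>

lemma handshake:
  assumes "loopless_multigraph G"
  shows "(\<Sum>v\<in>verts G. deg G v) = 2 * card (edges G)"
proof -
  have fin: "finite (verts G)" "finite (edges G)"
    using assms by (auto simp: loopless_multigraph_def)
  have "(\<Sum>v\<in>verts G. deg G v) = (\<Sum>v\<in>verts G. \<Sum>e | e \<in> edges G \<and> v \<in> ends G e. 1)"
    by (simp add: deg_def)
  also have "\<dots> = (\<Sum>e\<in>edges G. \<Sum>v | v \<in> verts G \<and> v \<in> ends G e. 1)"
    by (rule sum.swap_restrict[OF fin])
  also have "\<dots> = (\<Sum>e\<in>edges G. 2)"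
  proof (rule sum.cong)
    fix e assume "e \<in> edges G"
    then have "{v. v \<in> verts G \<and> v \<in> ends G e} = ends G e" "card (ends G e) = 2"
      using assms by (auto simp: loopless_multigraph_def)
    then show "(\<Sum>v | v \<in> verts G \<and> v \<in> ends G e. 1) = (2 :: nat)" by simp
  qed simp
  finally show ?thesis by simp
qed

text \<open>As a sum of indicators the degree splits over edges, so an inserted or altered edge
  contributes a separate summand.\<close>

lemma deg_eq_sum:
  assumes "finite (edges G)"
  shows "deg G v = (\<Sum>e\<in>edges G. of_bool (v \<in> ends G e))"
proof -
  have "{e \<in> edges G. v \<in> ends G e} = edges G \<inter> {e. v \<in> ends G e}" by auto
  then show ?thesis using assms by (simp add: deg_def sum.If_cases of_bool_def)
qed

lemma cycle_edge_deg_ge_2: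
  assumes cyc: "is_cycle G vs es" and len: "length vs = 4" and fin: "finite (edges G)"
    and e: "e \<in> set es" "v \<in> ends G e"
  shows "deg G v \<ge> 2"
proof -
  have len': "length es = 4" and dis: "distinct es" and sub: "set es \<subseteq> edges G"
    and ends: "\<And>i. i < 4 \<Longrightarrow> ends G (es ! i) = {vs ! i, vs ! (Suc i mod 4)}"
    using cyc len by (auto simp: is_cycle_def)
  obtain i where i: "i < 4" "e = es ! i"
    using e(1) len' by (auto simp: in_set_conv_nth)
  then obtain j where j: "j < 4" "v = vs ! j"
    using ends[OF i(1)] e(2) by auto (metis mod_less_divisor zero_less_numeral)
  \<comment> \<open>\<open>k\<close> is the cyclic predecessor of \<open>j\<close>, written without
    subtraction; \<open>es ! k\<close> and \<open>es ! j\<close> are the two cycle edges at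
    \<open>v\<close>.\<close>
  define k where "k = (j + 3) mod 4"
  have k: "k < 4" "k \<noteq> j" "Suc k mod 4 = j"
    using j(1) by (auto simp: k_def) presburger+
  have "{es ! j, es ! k} \<subseteq> {e \<in> edges G. v \<in> ends G e}"
    using ends[OF j(1)] ends[OF k(1)] j k sub len' by (auto simp: subset_iff)
  then have "card {es ! j, es ! k} \<le> deg G v"
    unfolding deg_def using fin by (intro card_mono) auto
  moreover have "es ! j \<noteq> es ! k"
    using dis j(1) k len' by (simp add: nth_eq_iff_index_eq)
  ultimately show ?thesis by simp
qed

lemma C4_pivotable_deg_ge_2:
  assumes G: "C4_pivotable G" and v: "v \<in> verts G"
  shows "deg G v \<ge> 2"
proof -
  obtain vs es S T where *: "is_cycle G vs es" "length vs = 4"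
    "spanning_tree G S" "spanning_tree G T" "S \<inter> T \<subseteq> set es"
    using G by (auto simp: C4_pivotable_def induced_cycle_def)
  have fin: "finite (edges G)" "finite (verts G)"
    using G by (auto simp: C4_pivotable_def loopless_multigraph_def)
  \<comment> \<open>The four cycle vertices supply a vertex \<open>u\<close> other than
    \<open>v\<close>; hence every spanning tree must have an edge at \<open>v\<close>.\<close>
  have "\<not> set vs \<subseteq> {v}"
    using *(1,2) card_mono[of "{v}" "set vs"] by (auto simp: is_cycle_def distinct_card)
  then obtain u where u: "u \<in> verts G" "u \<noteq> v"
    using *(1) by (auto simp: is_cycle_def)
  have inc: "\<exists>e\<in>R. v \<in> ends G e" if "spanning_tree G R" for R
    using that connected_has_incident_edge[of "G\<lparr>edges := R\<rparr>" u v] u v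
    by (auto simp: spanning_tree_def is_tree_def)
  obtain e f where ef: "e \<in> S" "v \<in> ends G e" "f \<in> T" "v \<in> ends G f"
    using inc *(3,4) by blast
  show ?thesis
  proof (cases "e = f")
    case True
    then show ?thesis using ef * fin by (intro cycle_edge_deg_ge_2) auto
  next
    case False
    have "{e, f} \<subseteq> {e \<in> edges G. v \<in> ends G e}"
      using ef *(3,4) by (auto simp: spanning_tree_def)
    then have "card {e, f} \<le> deg G v"
      unfolding deg_def using fin by (intro card_mono) auto
    then show ?thesis using False by simp
  qed
qed

section \<open>Building pivotable multigraphs\<close>

text \<open>The trees are recorded as connected graphs with the right number of edges, which is easier to
  maintain than acyclicity.\<close>

definition pivot_frame ::
  "('v, 'e) multigraph \<Rightarrow> 'v list \<Rightarrow> 'e list \<Rightarrow> 'e set \<Rightarrow> 'e set \<Rightarrow> bool" where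
  "pivot_frame G vs es S T \<longleftrightarrow>
     loopless_multigraph G \<and> induced_cycle G vs es \<and> length vs = 4 \<and>
     is_connected (G\<lparr>edges := S\<rparr>) \<and> is_connected (G\<lparr>edges := T\<rparr>) \<and>
     card S + 1 = card (verts G) \<and> card T + 1 = card (verts G) \<and>
     S \<union> T = edges G \<and> card (S \<inter> T) = 2 \<and> S \<inter> T \<subseteq> set es"

lemma pivot_frame_sym: "pivot_frame G vs es S T \<Longrightarrow> pivot_frame G vs es T S"
  by (auto simp: pivot_frame_def Int_commute)

text \<open>Inclusion and exclusion: the trees cover all edges and share two, so the edge count plus
  2 is twice the vertex count minus 2.\<close>

lemma pivot_frame_card_edges:
  assumes "pivot_frame G vs es S T"
  shows "card (edges G) + 4 = 2 * card (verts G)"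
proof -
  have "finite S" "finite T"
    using assms by (auto simp: pivot_frame_def loopless_multigraph_def dest: finite_subset[rotated])
  from card_Un_Int[OF this] show ?thesis
    using assms by (auto simp: pivot_frame_def)
qed

lemma pivot_frame_imp_pivotable:
  assumes F: "pivot_frame G vs es S T"
  shows "C4_pivotable G"
proof -
  have "spanning_tree G R" if "R = S \<or> R = T" for R
  proof -
    have R: "R \<subseteq> edges G" "is_connected (G\<lparr>edges := R\<rparr>)" "card R + 1 = card (verts G)"
      using F that by (auto simp: pivot_frame_def)
    have "loopless_multigraph (G\<lparr>edges := R\<rparr>)"
      using F R(1) by (auto simp: pivot_frame_def loopless_multigraph_def intro: finite_subset)
    then show ?thesis
      using R is_tree_if_connected_card[of "G\<lparr>edges := R\<rparr>"] by (simp add: spanning_tree_def)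
  qed
  then have "spanning_tree G S" "spanning_tree G T" by auto
  moreover have "int (card (edges G)) = 2 * int (card (verts G)) - 4"
    using pivot_frame_card_edges[OF F] by linarith
  ultimately show ?thesis
    using F unfolding C4_pivotable_def pivot_frame_def by blast
qed

text \<open>Every edge of \<open>H\<close> that is new or has changed its ends reaches a vertex
  outside \<open>G\<close>, so it is neither a chord of the cycle nor parallel to one of its
  edges.\<close>

lemma induced_cycle_extend:
  assumes ic: "induced_cycle G vs es" and V: "verts G \<subseteq> verts H" and E: "set es \<subseteq> edges H"
    and old: "\<And>e. e \<in> edges H \<Longrightarrow>
      e \<in> edges G \<and> ends H e = ends G e \<or> \<not> ends H e \<subseteq> verts G"
    and same: "\<And>e. e \<in> set es \<Longrightarrow> ends H e = ends G e"
  shows "induced_cycle H vs es"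
proof -
  have cyc: "is_cycle G vs es" using ic by (simp add: induced_cycle_def)
  have vs: "set vs \<subseteq> verts G" and es: "set es \<subseteq> edges G"
    using cyc by (auto simp: is_cycle_def)
  have sub: "ends G f \<subseteq> set vs" if f: "f \<in> set es" for f
  proof -
    obtain i where "i < length es" "f = es ! i" using f by (auto simp: in_set_conv_nth)
    moreover have "length es = length vs" "length vs > 0"
      using cyc by (simp_all add: is_cycle_def)
    moreover from this have "Suc i mod length vs < length vs" by (intro mod_less_divisor)
    ultimately show ?thesis using cyc nth_mem[of _ vs] by (simp add: is_cycle_def)
  qed
  have "is_cycle H vs es"
    using cyc V E same by (auto simp: is_cycle_def)
  moreover have "\<exists>f\<in>set es. ends H e = ends H f" if "e \<in> edges H" "ends H e \<subseteq> set vs" for e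
    using old[OF that(1)] that vs ic same by (auto simp: induced_cycle_def)
  moreover have "multiplicity H (ends H f) = 1" if f: "f \<in> set es" for f
  proof -
    have "multiplicity G (ends G f) = 1" using ic f by (simp add: induced_cycle_def)
    then obtain g where g: "{e \<in> edges G. ends G e = ends G f} = {g}"
      by (auto simp: multiplicity_def card_1_singleton_iff)
    have "{e \<in> edges H. ends H e = ends H f} = {f}"
    proof (intro equalityI subsetI)
      fix e assume e: "e \<in> {e \<in> edges H. ends H e = ends H f}"
      then have "ends H e \<subseteq> verts G" using same[OF f] sub[OF f] vs by auto
      then have "e \<in> {e \<in> edges G. ends G e = ends G f}"
        using old[of e] e same[OF f] by auto
      moreover have "f \<in> {e \<in> edges G. ends G e = ends G f}" using f es by auto
      ultimately show "e \<in> {f}" unfolding g by simp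
    qed (use f E in auto)
    then show ?thesis by (simp add: multiplicity_def)
  qed
  ultimately show ?thesis by (simp add: induced_cycle_def)
qed

text \<open>The vertex \<open>v\<close> becomes a leaf of both trees, through \<open>e\<close> in
  the first and \<open>e'\<close> in the second. For \<open>x = y\<close> these two edges are
  parallel.\<close>

lemma pivot_frame_add_degree_2:
  assumes F: "pivot_frame G vs es S T" and v: "v \<notin> verts G" and xy: "x \<in> verts G" "y \<in> verts G"
    and e: "e \<notin> edges G" "e' \<notin> edges G" "e \<noteq> e'"
  defines "H \<equiv> \<lparr>verts = insert v (verts G), edges = insert e (insert e' (edges G)),
    ends = (ends G)(e := {v, x}, e' := {v, y})\<rparr>"
  shows "pivot_frame H vs es (insert e S) (insert e' T)"
proof -
  have ll: "loopless_multigraph G" and ST: "S \<union> T = edges G"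
    and ic: "induced_cycle G vs es"
    using F by (auto simp: pivot_frame_def)
  have es: "set es \<subseteq> edges G" using ic by (auto simp: induced_cycle_def is_cycle_def)
  have fin: "finite S" "finite T" "finite (verts G)"
    using ll ST by (auto simp: loopless_multigraph_def dest: finite_subset[rotated])
  have "v \<noteq> x" "v \<noteq> y" using v xy by auto
  then have vx: "card {v, x} = 2" "card {v, y} = 2" by simp_all
  have "loopless_multigraph H"
    using ll vx xy unfolding H_def loopless_multigraph_def by auto
  moreover have "induced_cycle H vs es"
  proof (rule induced_cycle_extend[OF ic])
    fix a assume "a \<in> edges H"
    then show "a \<in> edges G \<and> ends H a = ends G a \<or> \<not> ends H a \<subseteq> verts G"
      using v e unfolding H_def by auto
  qed (use es e in \<open>auto simp: H_def\<close>)
  moreover have "is_connected (H\<lparr>edges := insert e S\<rparr>)"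
  proof -
    have "is_connected \<lparr>verts = insert v (verts G), edges = insert e S, ends = ends H\<rparr>"
      by (rule is_connected_add_leaf[where x = x])
        (use F xy e ST in \<open>auto simp: H_def pivot_frame_def\<close>)
    then show ?thesis by (simp add: H_def)
  qed
  moreover have "is_connected (H\<lparr>edges := insert e' T\<rparr>)"
  proof -
    have "is_connected \<lparr>verts = insert v (verts G), edges = insert e' T, ends = ends H\<rparr>"
      by (rule is_connected_add_leaf[where x = y])
        (use F xy e ST in \<open>auto simp: H_def pivot_frame_def\<close>)
    then show ?thesis by (simp add: H_def)
  qed
  moreover have "card (insert e S) + 1 = card (verts H)" "card (insert e' T) + 1 = card (verts H)"
    using F fin v e ST by (auto simp: H_def pivot_frame_def card_insert_if)
  moreover have "insert e S \<inter> insert e' T = S \<inter> T" using e ST by auto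
  moreover have "insert e S \<union> insert e' T = edges H" using ST by (auto simp: H_def)
  ultimately show ?thesis using F by (auto simp: pivot_frame_def)
qed

text \<open>The edge \<open>c\<close> becomes the half \<open>{v, x}\<close> of the subdivided edge, \<open>e\<close> is the other half.\<close>

lemma pivot_frame_add_degree_3:
  assumes F: "pivot_frame G vs es S T" and v: "v \<notin> verts G" and z: "z \<in> verts G"
    and c: "c \<in> S" "c \<notin> set es" "ends G c = {x, y}"
    and e: "e \<notin> edges G" "e' \<notin> edges G" "e \<noteq> e'"
  defines "H \<equiv> \<lparr>verts = insert v (verts G), edges = insert e (insert e' (edges G)),
    ends = (ends G)(c := {v, x}, e := {v, y}, e' := {v, z})\<rparr>"
  shows "pivot_frame H vs es (insert e S) (insert e' T)"
proof -
  have ll: "loopless_multigraph G" and ST: "S \<union> T = edges G" "S \<inter> T \<subseteq> set es"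
    and ic: "induced_cycle G vs es"
    using F by (auto simp: pivot_frame_def)
  have es: "set es \<subseteq> edges G" using ic by (auto simp: induced_cycle_def is_cycle_def)
  \<comment> \<open>Common edges of the trees lie on the cycle and \<open>c\<close> does not, so
    \<open>c\<close> is missing from \<open>T\<close>. Hence no edge of \<open>T\<close> changes its
    ends, and \<open>T\<close> merely gains a leaf.\<close>
  have cT: "c \<in> edges G" "c \<notin> T" "c \<noteq> e" "c \<noteq> e'" using c ST e by auto
  have xy: "x \<in> verts G" "y \<in> verts G"
    using ll cT(1) c(3) by (auto simp: loopless_multigraph_def)
  have fin: "finite S" "finite T" "finite (verts G)"
    using ll ST by (auto simp: loopless_multigraph_def dest: finite_subset[rotated])
  have "v \<noteq> x" "v \<noteq> y" "v \<noteq> z" using v xy z by auto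
  then have vx: "card {v, x} = 2" "card {v, y} = 2" "card {v, z} = 2" by simp_all
  have "loopless_multigraph H"
    using ll vx xy z unfolding H_def loopless_multigraph_def by auto
  moreover have "induced_cycle H vs es"
  proof (rule induced_cycle_extend[OF ic])
    fix a assume "a \<in> edges H"
    then show "a \<in> edges G \<and> ends H a = ends G a \<or> \<not> ends H a \<subseteq> verts G"
      using v e unfolding H_def by auto
  qed (use es e c in \<open>auto simp: H_def\<close>)
  moreover have "is_connected (H\<lparr>edges := insert e S\<rparr>)"
  proof -
    let ?r = "(adj (ends H) (insert e S))\<^sup>*"
    \<comment> \<open>In the enlarged \<open>S\<close> the old connection of \<open>x\<close> and
      \<open>y\<close> through \<open>c\<close> is replaced by the path through
      \<open>v\<close>.\<close>
    have vx: "(v, x) \<in> ?r"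
      using c cT by (auto simp: H_def intro!: r_into_rtrancl adjI[of c])
    have vy: "(v, y) \<in> ?r"
      using e by (auto simp: H_def intro!: r_into_rtrancl adjI[of e])
    have "is_connected \<lparr>verts = insert v (verts (G\<lparr>edges := S\<rparr>)), edges = insert e S, ends = ends H\<rparr>"
    proof (rule is_connected_insert_vertex)
      show "is_connected (G\<lparr>edges := S\<rparr>)" using F by (simp add: pivot_frame_def)
      show "(v, x) \<in> ?r" by (rule vx)
      show "(a, b) \<in> ?r"
        if "(a, b) \<in> adj (ends (G\<lparr>edges := S\<rparr>)) (edges (G\<lparr>edges := S\<rparr>))" for a b
      proof -
        from that obtain g where g: "g \<in> S" "ends G g = {a, b}" by (auto simp: adj_def)
        show ?thesis
        proof (cases "g = c")
          case True
          then have "a = x \<and> b = y \<or> a = y \<and> b = x" using g c by (auto simp: doubleton_eq_iff)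
          then show ?thesis using vx vy by (meson rtrancl_trans sym_adj_rtrancl)
        next
          case False
          then have "ends H g = {a, b}" using e g ST by (auto simp: H_def)
          then show ?thesis using g by (auto intro!: r_into_rtrancl adjI[of g])
        qed
      qed
    qed (use xy in simp)
    then show ?thesis by (simp add: H_def)
  qed
  moreover have "is_connected (H\<lparr>edges := insert e' T\<rparr>)"
  proof -
    have "is_connected \<lparr>verts = insert v (verts G), edges = insert e' T, ends = ends H\<rparr>"
      by (rule is_connected_add_leaf[where x = z])
        (use F z e ST cT in \<open>auto simp: H_def pivot_frame_def\<close>)
    then show ?thesis by (simp add: H_def)
  qed
  moreover have "card (insert e S) + 1 = card (verts H)" "card (insert e' T) + 1 = card (verts H)"
    using F fin v e ST by (auto simp: H_def pivot_frame_def card_insert_if)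
  moreover have "insert e S \<inter> insert e' T = S \<inter> T" using e ST by auto
  moreover have "insert e S \<union> insert e' T = edges H" using ST by (auto simp: H_def)
  ultimately show ?thesis using F by (auto simp: pivot_frame_def)
qed

section \<open>Extending realizations by one vertex\<close>

text \<open>Degrees form a function on an arbitrary vertex set instead of a sorted sequence, so that
  the induction can delete any vertex and lower degrees without renumbering. Edge names in
  \<open>nat\<close> leave fresh names available.\<close>

definition frame_realizable :: "'v set \<Rightarrow> ('v \<Rightarrow> nat) \<Rightarrow> bool" where
  "frame_realizable V d \<longleftrightarrow> (\<exists>(G :: ('v, nat) multigraph) vs es S T.
     pivot_frame G vs es S T \<and> verts G = V \<and> (\<forall>v\<in>V. deg G v = d v))"

lemma obtain_two_fresh:
  assumes "finite (E :: nat set)"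
  obtains e e' where "e \<notin> E" "e' \<notin> E" "e \<noteq> e'"
proof -
  obtain e where e: "e \<notin> E" using assms ex_new_if_finite infinite_UNIV_nat by blast
  obtain e' where "e' \<notin> insert e E"
    using assms ex_new_if_finite[of "insert e E"] infinite_UNIV_nat by auto
  with e that show ?thesis by auto
qed

lemma deg_outside:
  assumes "loopless_multigraph G" "v \<notin> verts G"
  shows "deg G v = 0"
  using assms by (auto simp: deg_def loopless_multigraph_def)

text \<open>The two indicators are added separately so that a vertex \<open>x = y\<close> gains
  2.\<close>

lemma frame_realizable_add_degree_2:
  assumes "frame_realizable V d'" "v \<notin> V" "x \<in> V" "y \<in> V" "d v = 2"
    and d: "\<And>u. u \<in> V \<Longrightarrow> d u = d' u + of_bool (u = x) + of_bool (u = y)"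
  shows "frame_realizable (insert v V) d"
proof -
  obtain G :: "('a, nat) multigraph" and vs es S T where
    F: "pivot_frame G vs es S T" and V: "verts G = V" and deg: "\<forall>v\<in>V. deg G v = d' v"
    using assms(1) by (auto simp: frame_realizable_def)
  have ll: "loopless_multigraph G" using F by (simp add: pivot_frame_def)
  then have fin: "finite (edges G)" by (simp add: loopless_multigraph_def)
  obtain e e' where e: "e \<notin> edges G" "e' \<notin> edges G" "e \<noteq> e'"
    using obtain_two_fresh[OF fin] .
  define H where "H = \<lparr>verts = insert v (verts G), edges = insert e (insert e' (edges G)),
    ends = (ends G)(e := {v, x}, e' := {v, y})\<rparr>"
  have "pivot_frame H vs es (insert e S) (insert e' T)"
    unfolding H_def using pivot_frame_add_degree_2[OF F] assms V e by simp
  moreover have "deg H u = d u" if u: "u \<in> insert v V" for u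
  proof -
    have "deg H u = (\<Sum>a\<in>edges H. of_bool (u \<in> ends H a))"
      using fin by (intro deg_eq_sum) (simp add: H_def)
    also have "\<dots> = of_bool (u \<in> {v, x}) + of_bool (u \<in> {v, y}) +
        (\<Sum>a\<in>edges G. of_bool (u \<in> ends H a))"
      using e fin by (simp add: H_def)
    also have "(\<Sum>a\<in>edges G. of_bool (u \<in> ends H a)) = deg G u"
      unfolding deg_eq_sum[OF fin] using e by (intro sum.cong) (auto simp: H_def)
    finally have *: "deg H u = of_bool (u \<in> {v, x}) + of_bool (u \<in> {v, y}) + deg G u" .
    show ?thesis
    proof (cases "u = v")
      case True
      then show ?thesis using * assms V deg_outside[OF ll] by simp
    next
      case False
      then show ?thesis using * u deg d by auto
    qed
  qed
  moreover have "verts H = insert v V" by (simp add: H_def V)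
  ultimately show ?thesis unfolding frame_realizable_def by blast
qed

text \<open>With at least five vertices there are at least six edges, hence one off the central
  cycle to subdivide. Subdivision keeps the degrees of its ends, so among the old vertices only
  \<open>z\<close> gains 1.\<close>

lemma frame_realizable_add_degree_3:
  assumes "frame_realizable V d'" "card V \<ge> 5" "v \<notin> V" "z \<in> V" "d v = 3"
    and d: "\<And>u. u \<in> V \<Longrightarrow> d u = d' u + of_bool (u = z)"
  shows "frame_realizable (insert v V) d"
proof -
  obtain G :: "('a, nat) multigraph" and vs es S0 T0 where
    F0: "pivot_frame G vs es S0 T0" and V: "verts G = V" and deg: "\<forall>v\<in>V. deg G v = d' v"
    using assms(1) by (auto simp: frame_realizable_def)
  have ll: "loopless_multigraph G" using F0 by (simp add: pivot_frame_def)
  then have fin: "finite (edges G)" by (simp add: loopless_multigraph_def)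
  have "length es = 4"
    using F0 by (auto simp: pivot_frame_def induced_cycle_def is_cycle_def)
  then have "card (set es) < card (edges G)"
    using pivot_frame_card_edges[OF F0] V assms(2) card_length[of es] by simp
  then have "\<not> edges G \<subseteq> set es" using card_mono[of "set es" "edges G"] by auto
  then obtain c where c: "c \<in> edges G" "c \<notin> set es" by auto
  then have "c \<in> S0 \<or> c \<in> T0" using F0 by (auto simp: pivot_frame_def)
  \<comment> \<open>The two trees are exchanged if necessary, so that the edge to be subdivided lies
    in \<open>S\<close>.\<close>
  then obtain S T where F: "pivot_frame G vs es S T" and cS: "c \<in> S"
    using F0 pivot_frame_sym by blast
  have cG: "ends G c \<subseteq> V" "card (ends G c) = 2"
    using ll c V by (auto simp: loopless_multigraph_def)
  then obtain x y where xy: "ends G c = {x, y}" "x \<noteq> y" by (auto simp: card_2_iff)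
  obtain e e' where e: "e \<notin> edges G" "e' \<notin> edges G" "e \<noteq> e'"
    using obtain_two_fresh[OF fin] .
  have ce: "c \<noteq> e" "c \<noteq> e'" using c e by auto
  define H where "H = \<lparr>verts = insert v (verts G), edges = insert e (insert e' (edges G)),
    ends = (ends G)(c := {v, x}, e := {v, y}, e' := {v, z})\<rparr>"
  have "pivot_frame H vs es (insert e S) (insert e' T)"
    unfolding H_def using pivot_frame_add_degree_3[OF F] assms V e cS c xy by simp
  moreover have "deg H u = d u" if u: "u \<in> insert v V" for u
  proof -
    have "deg H u = (\<Sum>a\<in>edges H. of_bool (u \<in> ends H a))"
      using fin by (intro deg_eq_sum) (simp add: H_def)
    also have "\<dots> = of_bool (u \<in> {v, y}) + of_bool (u \<in> {v, z}) +
        (\<Sum>a\<in>edges G. of_bool (u \<in> ends H a))"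
      using e ce fin by (simp add: H_def)
    \<comment> \<open>The summand of \<open>c\<close> is split off, since \<open>c\<close> is the
      only old edge whose ends change, from \<open>{x, y}\<close> to \<open>{v, x}\<close>.\<close>
    also have "(\<Sum>a\<in>edges G. of_bool (u \<in> ends H a)) =
        of_bool (u \<in> {v, x}) + (\<Sum>a\<in>edges G - {c}. of_bool (u \<in> ends H a))"
      using c ce fin by (subst sum.remove[of _ c]) (auto simp: H_def)
    also have "(\<Sum>a\<in>edges G - {c}. of_bool (u \<in> ends H a)) =
        (\<Sum>a\<in>edges G - {c}. of_bool (u \<in> ends G a))"
      using e by (intro sum.cong) (auto simp: H_def)
    finally have *: "deg H u = of_bool (u \<in> {v, y}) + of_bool (u \<in> {v, z}) +
      (of_bool (u \<in> {v, x}) + (\<Sum>a\<in>edges G - {c}. of_bool (u \<in> ends G a)))" .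
    have **: "deg G u = of_bool (u \<in> {x, y}) + (\<Sum>a\<in>edges G - {c}. of_bool (u \<in> ends G a))"
      unfolding deg_eq_sum[OF fin] using c fin xy by (subst sum.remove[of _ c]) auto
    show ?thesis
    proof (cases "u = v")
      case True
      then have "deg G u = 0" using assms V deg_outside[OF ll] by simp
      then show ?thesis using * ** True assms by simp
    next
      case False
      then have "d u = deg G u + of_bool (u = z)" using u deg d by auto
      then show ?thesis using * ** False xy(2) by auto
    qed
  qed
  moreover have "verts H = insert v V" by (simp add: H_def V)
  ultimately show ?thesis unfolding frame_realizable_def by blast
qed

text \<open>The base case is the bare 4-cycle. Its two trees are the paths that omit edge 3 and edge
  0 respectively; they share the edges 1 and 2.\<close>

lemma frame_realizable_C4:
  assumes dist: "distinct [a, b, c, e]" and d: "\<forall>v\<in>{a, b, c, e}. d v = 2"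
  shows "frame_realizable {a, b, c, e} d"
proof -
  define f where "f = (\<lambda>i::nat. if i = 0 then {a, b} else if i = 1 then {b, c}
    else if i = 2 then {c, e} else {e, a})"
  define G where "G = \<lparr>verts = {a, b, c, e}, edges = {0, 1, 2, 3}, ends = f\<rparr>"
  have f: "f 0 = {a, b}" "f (Suc 0) = {b, c}" "f 1 = {b, c}" "f 2 = {c, e}" "f 3 = {e, a}"
    by (simp_all add: f_def)
  have ll: "loopless_multigraph G"
    using dist by (auto simp: loopless_multigraph_def G_def f)
  have "is_cycle G [a, b, c, e] [0, 1, 2, 3]"
  proof -
    have "ends G ([0, 1, 2, 3] ! i) = {[a, b, c, e] ! i, [a, b, c, e] ! (Suc i mod 4)}"
      if "i < 4" for i
    proof -
      from that consider "i = 0" | "i = 1" | "i = 2" | "i = 3" by linarith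
      then show ?thesis by cases (simp_all add: G_def f)
    qed
    then show ?thesis using dist by (simp add: is_cycle_def G_def)
  qed
  moreover have "multiplicity G (f i) = 1" if "i \<in> {0, 1, 2, 3}" for i
  proof -
    have "{j \<in> edges G. ends G j = f i} = {i}"
      using that dist by (auto simp: G_def f doubleton_eq_iff)
    then show ?thesis by (simp add: multiplicity_def)
  qed
  ultimately have ic: "induced_cycle G [a, b, c, e] [0, 1, 2, 3]"
    by (auto simp: induced_cycle_def G_def)
  have path: "is_connected \<lparr>verts = {p, q, r, s}, edges = E, ends = f\<rparr>"
    if "(p, q) \<in> adj f E" "(q, r) \<in> adj f E" "(r, s) \<in> adj f E" for p q r s :: 'a and E
  proof -
    have "(p, u) \<in> (adj f E)\<^sup>*" if "u \<in> {p, q, r, s}" for u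
      using that \<open>(p, q) \<in> adj f E\<close> \<open>(q, r) \<in> adj f E\<close> \<open>(r, s) \<in> adj f E\<close>
      by (auto intro: rtrancl_into_rtrancl)
    then show ?thesis
      unfolding is_connected_adj by (auto intro: rtrancl_trans sym_adj_rtrancl)
  qed
  have "is_connected (G\<lparr>edges := {0, 1, 2}\<rparr>)"
    using path[of a b "{0, 1, 2}" c e] by (auto simp: G_def adj_def f)
  moreover have "is_connected (G\<lparr>edges := {1, 2, 3}\<rparr>)"
  proof -
    have "{b, c, e, a} = {a, b, c, e}" by auto
    then show ?thesis
      using path[of b c "{1, 2, 3}" e a] by (auto simp: G_def adj_def f)
  qed
  moreover have "{0, 1, 2} \<inter> {1, 2, 3} = {1, 2 :: nat}" by auto
  ultimately have "pivot_frame G [a, b, c, e] [0, 1, 2, 3] {0, 1, 2} {1, 2, 3}"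
    using ll ic dist by (auto simp: pivot_frame_def G_def)
  moreover have "deg G v = d v" if "v \<in> {a, b, c, e}" for v
  proof -
    have "deg G v = 2"
      using that dist by (subst deg_eq_sum) (auto simp: G_def f)
    then show ?thesis using d that by auto
  qed
  ultimately show ?thesis unfolding frame_realizable_def
    by (intro exI[of _ G] exI conjI) (auto simp: G_def)
qed

section \<open>Induction on the number of vertices\<close>

text \<open>The total excess of the degrees over 2 is \<open>2 * card V - 8\<close>, which is at
  least 2. So two units can be taken away, from two vertices or twice from one, with all degrees
  staying at least 2.\<close>

lemma ex_remove_two_units:
  fixes d :: "'v \<Rightarrow> nat"
  assumes fin: "finite V" and V: "card V \<ge> 5" and ge: "\<forall>u\<in>V. d u \<ge> 2"
    and sum: "(\<Sum>u\<in>V. d u) + 8 = 4 * card V"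
  shows "\<exists>x\<in>V. \<exists>y\<in>V. d x \<ge> 3 \<and> d y \<ge> 3 \<and> (x = y \<longrightarrow> d x \<ge> 4)"
proof -
  have "\<exists>x\<in>V. d x \<ge> 3"
  proof (rule ccontr)
    assume "\<not> ?thesis"
    then have "(\<Sum>u\<in>V. d u) \<le> (\<Sum>u\<in>V. 2)" by (intro sum_mono) force
    then show False using sum V by simp
  qed
  then obtain x where x: "x \<in> V" "d x \<ge> 3" by blast
  show ?thesis
  proof (cases "d x \<ge> 4")
    case True
    then show ?thesis using x by blast
  next
    case False
    have "\<exists>y\<in>V - {x}. d y \<ge> 3"
    proof (rule ccontr)
      assume "\<not> ?thesis"
      then have "(\<Sum>u\<in>V - {x}. d u) \<le> (\<Sum>u\<in>V - {x}. 2)" by (intro sum_mono) force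
      \<comment> \<open>With \<open>d x\<close> at most 3 the sum would be at most
        \<open>2 * card V + 1\<close>, below the prescribed \<open>4 * card V - 8\<close>.\<close>
      then show False using sum V x False fin by (simp add: sum.remove[of V x])
    qed
    then show ?thesis using x by blast
  qed
qed

text \<open>Deleting one vertex must lower the degree sum by 4: a vertex of degree 2 goes together
  with two further units, a vertex of degree 3 with one. Adding 8 on the left avoids subtraction of
  natural numbers.\<close>

lemma frame_realizable_if:
  assumes "finite V" "card V \<ge> 4" "\<forall>u\<in>V. d u \<ge> 2" "(\<Sum>u\<in>V. d u) + 8 = 4 * card V"
  shows "frame_realizable V d"
proof -
  obtain m where "m = card V" by simp
  then have "m \<ge> 4" using assms by simp
  then show ?thesis using assms \<open>m = card V\<close>
  proof (induction m arbitrary: V d rule: dec_induct)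
    case base
    have "card V = 4" using base by simp
    then obtain a b c e where V: "V = {a, b, c, e}" "distinct [a, b, c, e]"
      by (auto simp: card_Suc_eq numeral_eq_Suc)
    \<comment> \<open>Four degrees of at least 2 with sum 8 are all equal to 2.\<close>
    have "d v = 2" if "v \<in> V" for v
    proof (rule ccontr)
      assume "d v \<noteq> 2"
      then have "(\<Sum>u\<in>V. 2) < (\<Sum>u\<in>V. d u)"
        using base that by (intro sum_strict_mono_ex1) (force intro: le_neq_trans)+
      then show False using base by simp
    qed
    then show ?case using frame_realizable_C4[OF V(2)] V(1) by simp
  next
    case (step m)
    note fin = step.prems(1) and ge = step.prems(3) and sum = step.prems(4)
    have cV: "card V = Suc m" using step.prems by simp
    show ?case
    proof (cases "\<exists>v\<in>V. d v = 2")
      case True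
      then obtain v where v: "v \<in> V" "d v = 2" by blast
      obtain x y where xy: "x \<in> V" "y \<in> V" "d x \<ge> 3" "d y \<ge> 3" "x = y \<longrightarrow> d x \<ge> 4"
        using ex_remove_two_units[OF fin _ ge sum] cV step.hyps by auto
      let ?V = "V - {v}"
      \<comment> \<open>Degrees of at least 3 keep \<open>x\<close> and \<open>y\<close> apart from
        \<open>v\<close>.\<close>
      have xyV: "x \<in> ?V" "y \<in> ?V" using xy v by auto
      define d' where "d' u = d u - of_bool (u = x) - of_bool (u = y)" for u
      have d: "d u = d' u + of_bool (u = x) + of_bool (u = y)" for u
        using xy by (auto simp: d'_def)
      have "(\<Sum>u\<in>V. d u) = 2 + (\<Sum>u\<in>?V. d u)"
        using fin v by (simp add: sum.remove)
      also have "(\<Sum>u\<in>?V. d u) = (\<Sum>u\<in>?V. d' u) + 2"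
        unfolding d sum.distrib using fin xyV by (simp add: of_bool_def)
      finally have "(\<Sum>u\<in>?V. d' u) + 8 = 4 * card ?V"
        using sum cV v by simp
      moreover have "\<forall>u\<in>?V. d' u \<ge> 2"
        using ge xy by (auto simp: d'_def)
      ultimately have "frame_realizable ?V d'"
        using fin cV v step.hyps by (intro step.IH) auto
      then have "frame_realizable (insert v ?V) d"
        using xyV v(2) d by (intro frame_realizable_add_degree_2) auto
      then show ?thesis using v by (simp add: insert_absorb)
    next
      case False
      have ge3: "d u \<ge> 3" if "u \<in> V" for u
        using ge False that by (metis Suc_leI eval_nat_numeral(3) le_neq_implies_less)
      \<comment> \<open>Minimum degree 3 forces at least eight vertices, so enough remain after the
        deletion for an edge off the central cycle.\<close>
      then have "(\<Sum>u\<in>V. 3) \<le> (\<Sum>u\<in>V. d u)" by (intro sum_mono) auto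
      then have m: "m \<ge> 7" using sum cV by simp
      \<comment> \<open>The average degree is below 4.\<close>
      have "\<exists>v\<in>V. d v = 3"
      proof (rule ccontr)
        assume "\<not> ?thesis"
        then have "(\<Sum>u\<in>V. 4) \<le> (\<Sum>u\<in>V. d u)" using ge3 by (intro sum_mono) force
        then show False using sum by simp
      qed
      then obtain v where v: "v \<in> V" "d v = 3" by blast
      let ?V = "V - {v}"
      have cV': "card ?V = m" using cV v by simp
      then have "?V \<noteq> {}" using m by (metis card.empty not_numeral_le_zero)
      \<comment> \<open>Any remaining vertex will do, because all degrees are at least 3 and one
        unit can be spared.\<close>
      then obtain z where z: "z \<in> ?V" by blast
      define d' where "d' u = d u - of_bool (u = z)" for u
      have d: "d u = d' u + of_bool (u = z)" for u
        using z ge3[of z] by (auto simp: d'_def)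
      have "(\<Sum>u\<in>V. d u) = 3 + (\<Sum>u\<in>?V. d u)"
        using fin v by (simp add: sum.remove)
      also have "(\<Sum>u\<in>?V. d u) = (\<Sum>u\<in>?V. d' u) + 1"
        unfolding d sum.distrib using fin z by (simp add: of_bool_def)
      finally have "(\<Sum>u\<in>?V. d' u) + 8 = 4 * card ?V"
        using sum cV v by simp
      moreover have "\<forall>u\<in>?V. d' u \<ge> 2"
      proof
        fix u assume "u \<in> ?V"
        then show "d' u \<ge> 2" using ge3[of u] by (auto simp: d'_def)
      qed
      ultimately have "frame_realizable ?V d'"
        using fin cV' step.hyps by (intro step.IH) auto
      then have "frame_realizable (insert v ?V) d"
        using z v(2) d cV' m by (intro frame_realizable_add_degree_3) auto
      then show ?thesis using v by (simp add: insert_absorb)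
    qed
  qed
qed

section \<open>Characterization of the degree sequences\<close>

theorem theorem5p4:
  fixes n :: nat and d :: "nat \<Rightarrow> nat"
  assumes "n \<ge> 1" and "multigraphical n d"
  shows "(\<exists>G :: (nat, nat) multigraph. realization G n d \<and> C4_pivotable G) \<longleftrightarrow>
    (\<Sum>i=1..n. int (d i)) = 4 * (int n - 1) - 4 \<and> d n \<ge> 2"
proof
  assume "\<exists>G :: (nat, nat) multigraph. realization G n d \<and> C4_pivotable G"
  then obtain G :: "(nat, nat) multigraph" where G: "loopless_multigraph G" "verts G = {1..n}"
    "\<forall>i\<in>{1..n}. deg G i = d i" "C4_pivotable G"
    by (auto simp: realization_def)
  have "(\<Sum>i=1..n. d i) = 2 * card (edges G)"
    using handshake[OF G(1)] G(2,3) by simp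
  then have "(\<Sum>i=1..n. int (d i)) = 2 * int (card (edges G))"
    by (metis of_nat_sum of_nat_mult of_nat_numeral)
  moreover have "int (card (edges G)) = 2 * int n - 4"
    using G(2,4) by (simp add: C4_pivotable_def)
  moreover have "d n \<ge> 2"
    using C4_pivotable_deg_ge_2[OF G(4), of n] G(2,3) assms(1) by simp
  ultimately show "(\<Sum>i=1..n. int (d i)) = 4 * (int n - 1) - 4 \<and> d n \<ge> 2" by simp
next
  assume *: "(\<Sum>i=1..n. int (d i)) = 4 * (int n - 1) - 4 \<and> d n \<ge> 2"
  have ge: "\<forall>i\<in>{1..n}. d i \<ge> 2"
  proof
    fix i assume "i \<in> {1..n}"
    then have "d n \<le> d i" using assms(2) by (auto simp: multigraphical_def degree_sequence_def)
    then show "d i \<ge> 2" using * by simp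
  qed
  have "int (\<Sum>i=1..n. d i) + 8 = 4 * int n" using * by simp
  then have sum: "(\<Sum>i=1..n. d i) + 8 = 4 * n" by linarith
  \<comment> \<open>Comparing \<open>2 * n\<close> with the sum \<open>4 * n - 8\<close> yields the
    four vertices at which the induction starts.\<close>
  have "(\<Sum>i=1..n. 2) \<le> (\<Sum>i=1..n. d i)" using ge by (intro sum_mono) auto
  then have "n \<ge> 4" using sum by simp
  then have "frame_realizable {1..n} d"
    using ge sum by (intro frame_realizable_if) auto
  then obtain G :: "(nat, nat) multigraph" and vs es S T where
    F: "pivot_frame G vs es S T" and G: "verts G = {1..n}" "\<forall>i\<in>{1..n}. deg G i = d i"
    unfolding frame_realizable_def by blast
  have "realization G n d" using F G by (simp add: realization_def pivot_frame_def)
  then show "\<exists>G :: (nat, nat) multigraph. realization G n d \<and> C4_pivotable G"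
    using pivot_frame_imp_pivotable[OF F] by blast
qed

end
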